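(* For all $n \ge 1$, the median Genocchi number $h_n$ equals the number of permutations $\sigma$ of $[2n]$ such that for every $i\in[2n-1]$ with $\sigma(i)>\sigma(i+1)$, the value $\sigma(i)$ is even and $\sigma(i+1)$ is odd.
   Context: A Dumont derangement is a permutation $\sigma\in\mathfrak S_{2N}$ with $2i>\sigma(2i)$ and $2i-1<\sigma(2i-1)$ for all $i=1,\dots,N$. For $n\ge 0$, the median Genocchi number $h_n$ is the number of Dumont derangements in $\mathfrak S_{2n+2}$. *)

theory Defs
  imports "HOL-Combinatorics.Permutations"
begin

text \<open>
  A permutation of \<open>[m] = {1, \<dots>, m}\<close> is a function \<open>\<sigma> :: nat \<Rightarrow> nat\<close> with
  \<open>\<sigma> permutes {1..m}\<close>. Such a function is the identity outside \<open>{1..m}\<close>, so these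
  functions correspond one-to-one to the elements of the symmetric group.
\<close>

definition dumont_derangement :: "nat \<Rightarrow> (nat \<Rightarrow> nat) \<Rightarrow> bool" where
  "dumont_derangement N \<sigma> \<longleftrightarrow>
     \<sigma> permutes {1..2 * N} \<and>
     (\<forall>i\<in>{1..N}. 2 * i > \<sigma> (2 * i) \<and> 2 * i - 1 < \<sigma> (2 * i - 1))"

definition median_genocchi :: "nat \<Rightarrow> nat" where
  "median_genocchi n = card {\<sigma>. dumont_derangement (n + 1) \<sigma>}"

end

theory Submission
  imports Defs "HOL-Combinatorics.Cycles" "HOL-Combinatorics.Orbits"
begin

text \<open>
  Call a set of numbers good if all its even members are smaller than all its odd members. Over
  every finite set \<open>V\<close> of numbers, two counts satisfy the same recursion
  \<open>(\<Sum>S. (-1) ^ card S * f (V - S)) = 0\<close>, where \<open>S\<close> ranges over the good subsets of \<open>V\<close>, so they agree.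

  For words on \<open>V\<close> whose descents all go from even to odd this is inclusion-exclusion over a decreasing
  prefix without such descents; its set of letters is precisely a good set. For permutations of \<open>V\<close> with
  \<open>\<sigma> i \<le> i\<close> at even and \<open>i \<le> \<sigma> i\<close> at odd \<open>i\<close>, a permanent, it is the MacMahon master theorem: the
  principal minor of the matrix on \<open>S\<close> is 1 if \<open>S\<close> is good and 0 otherwise. On \<open>{1..2 * n}\<close> the latter
  permutations are Dumont derangements of \<open>{1..2 * n + 2}\<close> in disguise.
\<close>

section \<open>Signed counts of permutations and the multilinear master theorem\<close>

text \<open>Reindexing along \<open>h\<close> shows that the sum is its own negative. A fixed point
  of \<open>h\<close> is harmless, since its weight is its own negative too.\<close>

lemma sum_sign_reversing_involution:
  fixes g :: "'a \<Rightarrow> int"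
  assumes "\<And>x. x \<in> A \<Longrightarrow> h x \<in> A" "\<And>x. x \<in> A \<Longrightarrow> h (h x) = x"
    and "\<And>x. x \<in> A \<Longrightarrow> g (h x) = - g x"
  shows "sum g A = 0"
proof -
  have "sum g A = (\<Sum>x\<in>A. - g x)"
    by (rule sum.reindex_bij_witness[of A h h]) (use assms in auto)
  then show ?thesis by (simp add: sum_negf)
qed

text \<open>For finite \<open>V\<close> and the 0-1 matrix \<open>A\<close>, the cardinality of this
  set is the permanent of the submatrix on \<open>V\<close>, and the sum of \<open>sign\<close> over
  it is the principal minor.\<close>

definition perms_on :: "('a \<Rightarrow> 'a \<Rightarrow> bool) \<Rightarrow> 'a set \<Rightarrow> ('a \<Rightarrow> 'a) set" where
  "perms_on A V = {\<sigma>. \<sigma> permutes V \<and> (\<forall>i\<in>V. A i (\<sigma> i))}"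

lemma perms_on_empty [simp]: "perms_on A {} = {id}"
  by (auto simp: perms_on_def)

lemma finite_perms_on [simp]: "finite V \<Longrightarrow> finite (perms_on A V)"
  unfolding perms_on_def by (rule finite_subset[OF _ finite_permutations[of V]]) auto

lemma sign_cycle_of_list:
  "distinct cs \<Longrightarrow> cs \<noteq> [] \<Longrightarrow> sign (cycle_of_list cs) = (-1) ^ (length cs - 1)"
proof (induction cs rule: cycle_of_list.induct)
  case (1 i j cs)
  then show ?case
    unfolding cycle_of_list.simps
    by (subst sign_compose) (auto simp: permutation_swap_id permutation_of_cycle sign_swap_id)
qed auto

lemma perm_restrict_permutes:
  assumes "\<tau> permutes V" "finite V" "S \<subseteq> V" "\<tau> ` S \<subseteq> S"
  shows "perm_restrict \<tau> S permutes S"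
  using assms
  by (intro inj_imp_permutes)
     (auto simp: perm_restrict_def inj_on_def inj_eq[OF permutes_inj] intro: finite_subset)

text \<open>Toggling a cycle of \<^term>\<open>\<tau>\<close> in or out of an invariant set \<^term>\<open>S\<close> changes the sign of
  \<^term>\<open>(-1) ^ card S * sign (perm_restrict \<tau> S)\<close>, a cycle of length \<^term>\<open>k\<close> having
  sign \<^term>\<open>(-1) ^ (k - 1)\<close>.\<close>

lemma sum_invariant_subsets_sign:
  assumes \<tau>: "\<tau> permutes V" and fin: "finite V" and ne: "V \<noteq> {}"
  shows "(\<Sum>S | S \<subseteq> V \<and> \<tau> ` S \<subseteq> S. (-1) ^ card S * sign (perm_restrict \<tau> S)) = 0"
proof -
  obtain v where v: "v \<in> V" using ne by blast
  have perm: "permutation \<tau>" using \<tau> fin by (rule permutes_imp_permutation[rotated])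
  \<comment> \<open>The cycle of \<open>\<tau>\<close> through the chosen \<open>v\<close>. An
    invariant subset of \<open>V\<close> contains it or is disjoint from it, according to whether it
    contains \<open>v\<close>.\<close>
  define C where "C = set (support \<tau> v)"
  have C: "C = range (\<lambda>i. (\<tau> ^^ i) v)" unfolding C_def by (rule support_set[OF perm])
  have vC: "v \<in> C" unfolding C by (rule range_eqI[of _ _ 0]) simp
  have CV: "C \<subseteq> V"
    unfolding C using permutes_in_image[OF permutes_funpow[OF \<tau>]] v by auto
  have \<tau>C: "\<tau> ` C \<subseteq> C" unfolding C by (auto intro: range_eqI[of _ _ "Suc _"])
  have CS: "C \<subseteq> S" if "v \<in> S" "\<tau> ` S \<subseteq> S" for S
  proof -
    have "(\<tau> ^^ i) v \<in> S" for i using that by (induction i) auto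
    then show ?thesis unfolding C by auto
  qed
  \<comment> \<open>An injective self-map of a finite set is onto, so invariance also passes to
    preimages.\<close>
  have inv: "x \<in> S" if "\<tau> x \<in> S" "\<tau> ` S \<subseteq> S" "S \<subseteq> V" for x S
  proof -
    have "finite S" using that(3) fin finite_subset by blast
    then have "\<tau> ` S = S"
      using that(2) by (intro endo_inj_surj inj_on_subset[OF permutes_inj[OF \<tau>]]) auto
    then have "\<tau> x \<in> \<tau> ` S" using that(1) by simp
    then show ?thesis by (simp add: inj_image_mem_iff[OF permutes_inj[OF \<tau>]])
  qed
  have disj: "C \<inter> S = {}" if "v \<notin> S" "\<tau> ` S \<subseteq> S" "S \<subseteq> V" for S
  proof -
    have "(\<tau> ^^ i) v \<notin> S" for i
      by (induction i) (use that inv in auto)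
    then show ?thesis unfolding C by auto
  qed
  have "perm_restrict \<tau> C = cycle_of_list (support \<tau> v)"
  proof
    fix x
    show "perm_restrict \<tau> C x = cycle_of_list (support \<tau> v) x"
      using cycle_restrict[OF perm, of x v] id_outside_supp[of x "support \<tau> v"]
      by (auto simp: perm_restrict_def C_def)
  qed
  moreover have "distinct (support \<tau> v)" by (rule cycle_of_permutation[OF perm])
  moreover have "support \<tau> v \<noteq> []" using vC unfolding C_def by (metis empty_iff list.set(1))
  ultimately have "sign (perm_restrict \<tau> C) = (-1) ^ (card C - 1)" 
    using sign_cycle_of_list[of "support \<tau> v"] distinct_card[of "support \<tau> v"]
    by (simp add: C_def)
  moreover have "card C \<noteq> 0" using vC CV fin by (metis card_0_eq empty_iff finite_subset)
  ultimately have sC: "(-1) ^ card C * sign (perm_restrict \<tau> C) = (-1 :: int)"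
    by (cases "card C") auto
  define w where "w S = (-1) ^ card S * sign (perm_restrict \<tau> S)" for S
  have w_Un: "w (S \<union> C) = - w S" if "v \<notin> S" "\<tau> ` S \<subseteq> S" "S \<subseteq> V" for S
  proof -
    have d: "S \<inter> C = {}" using disj that by blast
    have f: "finite S" "finite C" using that CV fin finite_subset by auto
    have pS: "perm_restrict \<tau> S permutes S" and pC: "perm_restrict \<tau> C permutes C"
      using perm_restrict_permutes[OF \<tau> fin] that CV \<tau>C by auto
    have "perm_restrict \<tau> (S \<union> C) = perm_restrict \<tau> S \<circ> perm_restrict \<tau> C"
      using perm_restrict_union[OF pS pC d] by simp
    then have "sign (perm_restrict \<tau> (S \<union> C)) = sign (perm_restrict \<tau> S) * sign (perm_restrict \<tau> C)"
      using sign_compose permutes_imp_permutation f pS pC by metis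
    then have "w (S \<union> C) = w S * ((-1) ^ card C * sign (perm_restrict \<tau> C))"
      unfolding w_def card_Un_disjoint[OF f d] by (simp add: power_add)
    then show ?thesis using sC by simp
  qed
  define h where "h S = (if v \<in> S then S - C else S \<union> C)" for S
  have "(\<Sum>S | S \<subseteq> V \<and> \<tau> ` S \<subseteq> S. w S) = 0"
  proof (rule sum_sign_reversing_involution[of _ h])
    fix S assume S: "S \<in> {S. S \<subseteq> V \<and> \<tau> ` S \<subseteq> S}"
    have diff: "\<tau> ` (S - C) \<subseteq> S - C" using S inv[OF _ \<tau>C CV] by auto
    show "h S \<in> {S. S \<subseteq> V \<and> \<tau> ` S \<subseteq> S}"
      using S CV \<tau>C diff by (auto simp: h_def)
    show "h (h S) = S"
      using S CS[of S] disj[of S] vC by (auto simp: h_def)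
    show "w (h S) = - w S"
    proof (cases "v \<in> S")
      case True
      then have "S - C \<union> C = S" using CS[of S] S by auto
      moreover have "S - C \<subseteq> V" using S by auto
      ultimately have "w S = - w (S - C)" using w_Un[of "S - C"] vC diff by simp
      then show ?thesis using True by (simp add: h_def)
    qed (use w_Un S in \<open>auto simp: h_def\<close>)
  qed
  then show ?thesis by (simp add: w_def)
qed

text \<open>A permutation of \<open>V\<close> that preserves \<open>S\<close> also preserves
  \<open>V - S\<close>, so it amounts to a pair of permutations of the two blocks; only the first
  one carries its sign.\<close>

lemma perms_on_split:
  assumes fin: "finite V" and SV: "S \<subseteq> V"
  shows "(\<Sum>\<pi>\<in>perms_on A S. sign \<pi>) * int (card (perms_on A (V - S))) =
    (\<Sum>\<tau> | \<tau> \<in> perms_on A V \<and> \<tau> ` S \<subseteq> S. sign (perm_restrict \<tau> S))"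
proof -
  let ?T = "V - S"
  have "(\<Sum>\<pi>\<in>perms_on A S. sign \<pi>) * int (card (perms_on A ?T)) =
      (\<Sum>(\<pi>, \<rho>)\<in>perms_on A S \<times> perms_on A ?T. sign \<pi>)"
    by (simp add: sum.cartesian_product[symmetric] sum_distrib_right mult.commute)
  also have "\<dots> = (\<Sum>\<tau> | \<tau> \<in> perms_on A V \<and> \<tau> ` S \<subseteq> S. sign (perm_restrict \<tau> S))"
  proof (rule sum.reindex_bij_witness[of _ "\<lambda>\<tau>. (perm_restrict \<tau> S, perm_restrict \<tau> ?T)"
        "\<lambda>(\<pi>, \<rho>) x. if x \<in> S then \<pi> x else \<rho> x"], goal_cases)
    case (1 p)
    then obtain \<pi> \<rho> where p: "p = (\<pi>, \<rho>)" and \<pi>: "\<pi> permutes S" and \<rho>: "\<rho> permutes ?T"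
      by (auto simp: perms_on_def)
    show ?case
      using permutes_not_in[OF \<pi>] permutes_not_in[OF \<rho>]
      unfolding p by (auto simp: perm_restrict_def fun_eq_iff)
  next
    case (2 p)
    then obtain \<pi> \<rho> where p: "p = (\<pi>, \<rho>)" and \<pi>: "\<pi> permutes S" and \<rho>: "\<rho> permutes ?T"
      and A: "\<And>i. i \<in> S \<Longrightarrow> A i (\<pi> i)" "\<And>i. i \<in> ?T \<Longrightarrow> A i (\<rho> i)"
      by (auto simp: perms_on_def)
    \<comment> \<open>Each factor is the identity on the block of the other, so gluing them is
      composing them.\<close>
    have eq: "(\<lambda>x. if x \<in> S then \<pi> x else \<rho> x) = \<pi> \<circ> \<rho>"
    proof
      fix x
      show "(if x \<in> S then \<pi> x else \<rho> x) = (\<pi> \<circ> \<rho>) x"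
        using permutes_not_in[OF \<rho>, of x] permutes_in_image[OF \<rho>, of x]
          permutes_not_in[OF \<pi>, of "\<rho> x"]
        by (cases "x \<in> S"; cases "x \<in> V") auto
    qed
    have "\<pi> permutes V" "\<rho> permutes V"
      using \<pi> \<rho> permutes_subset SV by blast+
    then have "\<pi> \<circ> \<rho> permutes V" by (rule permutes_compose[rotated])
    then show ?case
      unfolding p perms_on_def using permutes_in_image[OF \<pi>] A by (auto simp: eq[symmetric])
  next
    case (3 \<tau>)
    then have \<tau>: "\<tau> permutes V" by (auto simp: perms_on_def)
    show ?case using permutes_not_in[OF \<tau>] SV by (auto simp: perm_restrict_def fun_eq_iff)
  next
    case (4 \<tau>)
    then have \<tau>: "\<tau> permutes V" and S: "\<tau> ` S \<subseteq> S" by (auto simp: perms_on_def)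
    have "finite S" using SV fin finite_subset by blast
    then have "\<tau> ` S = S"
      using S by (intro endo_inj_surj inj_on_subset[OF permutes_inj[OF \<tau>]]) auto
    then have T: "\<tau> ` ?T \<subseteq> ?T"
      using permutes_image[OF \<tau>] image_set_diff[OF permutes_inj[OF \<tau>]] by auto
    have "perm_restrict \<tau> S permutes S" "perm_restrict \<tau> ?T permutes ?T"
      using perm_restrict_permutes[OF \<tau> fin _ S] perm_restrict_permutes[OF \<tau> fin _ T] SV by auto
    then show ?case using 4 SV by (auto simp: perms_on_def perm_restrict_def)
  next
    case (5 p)
    then obtain \<pi> \<rho> where p: "p = (\<pi>, \<rho>)" and \<pi>: "\<pi> permutes S"
      by (auto simp: perms_on_def)
    have "perm_restrict (\<lambda>x. if x \<in> S then \<pi> x else \<rho> x) S = \<pi>"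
      using permutes_not_in[OF \<pi>] by (auto simp: perm_restrict_def fun_eq_iff)
    then show ?case by (simp add: p)
  qed
  finally show ?thesis .
qed

text \<open>The multilinear part of the MacMahon master theorem, for the 0-1 matrix \<^term>\<open>A\<close>.\<close>

lemma sum_minor_permanent:
  assumes "finite V" "V \<noteq> {}"
  shows "(\<Sum>S\<in>Pow V. (-1) ^ card S * (\<Sum>\<pi>\<in>perms_on A S. sign \<pi>) *
    int (card (perms_on A (V - S)))) = 0"
proof -
  have "(\<Sum>S\<in>Pow V. (-1) ^ card S * (\<Sum>\<pi>\<in>perms_on A S. sign \<pi>) * int (card (perms_on A (V - S)))) =
      (\<Sum>S\<in>Pow V. \<Sum>\<tau> | \<tau> \<in> perms_on A V \<and> \<tau> ` S \<subseteq> S. (-1) ^ card S * sign (perm_restrict \<tau> S))"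
    using perms_on_split[OF assms(1), of _ A]
    by (intro sum.cong) (auto simp: mult.assoc simp flip: sum_distrib_left)
  \<comment> \<open>Exchanging the sums fixes \<open>\<tau>\<close> and lets \<open>S\<close> run
    over its invariant sets, where the signs cancel.\<close>
  also have "\<dots> = (\<Sum>\<tau>\<in>perms_on A V. \<Sum>S | S \<in> Pow V \<and> \<tau> ` S \<subseteq> S.
      (-1) ^ card S * sign (perm_restrict \<tau> S))"
    using assms by (intro sum.swap_restrict) auto
  also have "\<dots> = 0"
    using sum_invariant_subsets_sign[OF _ assms] by (intro sum.neutral) (auto simp: perms_on_def)
  finally show ?thesis .
qed

section \<open>Principal minors of the Dumont matrix\<close>

text \<open>Weak form of the Dumont inequalities: loops are allowed, so the matrix has ones on its
  diagonal.\<close>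

definition dumont_arc :: "nat \<Rightarrow> nat \<Rightarrow> bool" where
  "dumont_arc i j \<longleftrightarrow> (if even i then j \<le> i else i \<le> j)"

text \<open>In the decreasing word on a finite set of this kind all odd letters precede all even
  ones, so no descent goes from even to odd.\<close>

definition evens_before_odds :: "nat set \<Rightarrow> bool" where
  "evens_before_odds S \<longleftrightarrow> (\<forall>a\<in>S. \<forall>b\<in>S. even a \<longrightarrow> odd b \<longrightarrow> a < b)"

text \<open>A forced fixed point can be deleted. The two sets are literally equal because a
  permutation is the identity outside its ground set.\<close>

lemma perms_on_fixed:
  assumes "v \<in> S" "\<And>\<pi>. \<pi> \<in> perms_on A S \<Longrightarrow> \<pi> v = v" "A v v"
  shows "perms_on A S = perms_on A (S - {v})"
proof (intro equalityI subsetI)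
  fix \<pi> assume \<pi>: "\<pi> \<in> perms_on A S"
  have "\<pi> permutes S - {v}"
    by (rule permutes_superset[of _ S]) (use \<pi> assms(2) in \<open>auto simp: perms_on_def\<close>)
  then show "\<pi> \<in> perms_on A (S - {v})" using \<pi> by (auto simp: perms_on_def)
next
  fix \<pi> assume \<pi>: "\<pi> \<in> perms_on A (S - {v})"
  then have p: "\<pi> permutes S - {v}" by (auto simp: perms_on_def)
  have "\<pi> permutes S" using permutes_subset[OF p] by blast
  moreover have "\<pi> v = v" using permutes_not_in[OF p] by simp
  ultimately show "\<pi> \<in> perms_on A S" using \<pi> assms(3) by (auto simp: perms_on_def)
qed

text \<open>If the least element of \<^term>\<open>S\<close> is even or the largest is odd, it is fixed by every
  permutation; otherwise both rows are unrestricted and exchanging them reverses the sign.\<close>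

lemma sum_sign_dumont:
  assumes "finite S"
  shows "(\<Sum>\<pi>\<in>perms_on dumont_arc S. sign \<pi>) = (if evens_before_odds S then 1 else 0)"
  using assms
proof (induction "card S" arbitrary: S rule: less_induct)
  case less
  show ?case
  proof (cases "S = {}")
    case True
    then show ?thesis by (simp add: evens_before_odds_def)
  next
    case False
    define a where "a = Min S"
    define z where "z = Max S"
    have a: "a \<in> S" "\<And>x. x \<in> S \<Longrightarrow> a \<le> x" and z: "z \<in> S" "\<And>x. x \<in> S \<Longrightarrow> x \<le> z"
      using False less.prems by (auto simp: a_def z_def)
    have into: "\<pi> x \<in> S" if "\<pi> \<in> perms_on dumont_arc S" "x \<in> S" for \<pi> x
      using that permutes_in_image[of \<pi> S x] by (simp add: perms_on_def)
    have arc: "dumont_arc x (\<pi> x)" if "\<pi> \<in> perms_on dumont_arc S" "x \<in> S" for \<pi> x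
      using that by (auto simp: perms_on_def)
    have step: ?thesis if v: "v \<in> S" "\<And>\<pi>. \<pi> \<in> perms_on dumont_arc S \<Longrightarrow> \<pi> v = v"
      and good: "evens_before_odds S = evens_before_odds (S - {v})" for v
    proof -
      have "dumont_arc v v" by (simp add: dumont_arc_def)
      then have "perms_on dumont_arc S = perms_on dumont_arc (S - {v})"
        using perms_on_fixed[of v S dumont_arc] v by blast
      moreover have "card (S - {v}) < card S" using v less.prems by (meson card_Diff1_less)
      ultimately show ?thesis using less.hyps[of "S - {v}"] less.prems good by simp
    qed
    consider "even a" | "odd z" | "odd a" "even z" by blast
    then show ?thesis
    proof cases
      case 1
      show ?thesis
      proof (rule step[OF a(1)])
        fix \<pi> assume "\<pi> \<in> perms_on dumont_arc S"
        then show "\<pi> a = a" using arc[of \<pi> a] a into[of \<pi> a] 1 by (force simp: dumont_arc_def)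
      next
        \<comment> \<open>An even minimum lies below every odd member, so deleting it affects
          goodness in neither direction.\<close>
        have "a < b" if "b \<in> S" "odd b" for b using a(2)[OF that(1)] that 1 by (cases "a = b") auto
        then show "evens_before_odds S = evens_before_odds (S - {a})"
          using 1 unfolding evens_before_odds_def by blast
      qed
    next
      case 2
      show ?thesis
      proof (rule step[OF z(1)])
        fix \<pi> assume "\<pi> \<in> perms_on dumont_arc S"
        then show "\<pi> z = z" using arc[of \<pi> z] z into[of \<pi> z] 2 by (force simp: dumont_arc_def)
      next
        have "b < z" if "b \<in> S" "even b" for b using z(2)[OF that(1)] that 2 by (cases "z = b") auto
        then show "evens_before_odds S = evens_before_odds (S - {z})"
          using 2 unfolding evens_before_odds_def by blast
      qed
    next
      case 3
      then have az: "a \<noteq> z" by blast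
      have bad: "\<not> evens_before_odds S"
        using 3 a(1) z(1) a(2)[OF z(1)] unfolding evens_before_odds_def by (meson leD)
      have "(\<Sum>\<pi>\<in>perms_on dumont_arc S. sign \<pi>) = 0"
      proof (rule sum_sign_reversing_involution[of _ "\<lambda>\<pi>. \<pi> \<circ> transpose a z"])
        fix \<pi> assume \<pi>: "\<pi> \<in> perms_on dumont_arc S"
        then have p: "\<pi> permutes S" by (simp add: perms_on_def)
        show "\<pi> \<circ> transpose a z \<in> perms_on dumont_arc S"
          using permutes_compose[OF permutes_swap_id[OF a(1) z(1)] p] \<pi> 3 a z into[OF \<pi>]
          by (auto simp: perms_on_def dumont_arc_def transpose_def)
        show "\<pi> \<circ> transpose a z \<circ> transpose a z = \<pi>" by (simp add: comp_assoc)
        show "sign (\<pi> \<circ> transpose a z) = - sign \<pi>"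
          using permutes_imp_permutation[OF less.prems p] az
          by (simp add: sign_compose permutation_swap_id sign_swap_id)
      qed
      then show ?thesis using bad by simp
    qed
  qed
qed

section \<open>Inclusion-exclusion for words with forbidden steps\<close>

definition words_on :: "('a \<Rightarrow> 'a \<Rightarrow> bool) \<Rightarrow> 'a set \<Rightarrow> 'a list set" where
  "words_on R V = {w. distinct w \<and> set w = V \<and> successively R w}"

lemma finite_words_on [simp]: "finite V \<Longrightarrow> finite (words_on R V)"
  unfolding words_on_def
  by (rule finite_subset[OF _ finite_lists_length_eq[of V "card V"]]) (auto simp: distinct_card)

lemma words_on_empty [simp]: "words_on R {} = {[]}"
  by (auto simp: words_on_def)

text \<open>A chain \<^term>\<open>S\<close> stands for its decreasing word. The pair \<^term>\<open>(S, w)\<close> is cancelled by moving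
  the letter at the interface, either \<^term>\<open>Min S\<close> or \<^term>\<open>hd w\<close>, to the other side.\<close>

lemma sum_chain_words:
  fixes B :: "'a::linorder \<Rightarrow> 'a \<Rightarrow> bool"
  assumes fin: "finite V" and ne: "V \<noteq> {}"
    and trans: "transp B" and less: "\<And>a b. B a b \<Longrightarrow> b < a"
  shows "(\<Sum>S | S \<subseteq> V \<and> (\<forall>a\<in>S. \<forall>b\<in>S. b < a \<longrightarrow> B a b).
    (-1) ^ card S * int (card (words_on (\<lambda>a b. \<not> B a b) (V - S)))) = 0"
proof -
  define chain where "chain S \<longleftrightarrow> (\<forall>a\<in>S. \<forall>b\<in>S. b < a \<longrightarrow> B a b)" for S
  define W where "W S = words_on (\<lambda>a b. \<not> B a b) (V - S)" for S
  \<comment> \<open>Says that \<open>hd w\<close> may be appended to the decreasing word on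
    \<open>S\<close>; for empty \<open>S\<close> any first letter may.\<close>
  define movable where "movable S w \<longleftrightarrow> w \<noteq> [] \<and> (\<forall>s\<in>S. B s (hd w))" for S w
  define h where "h = (\<lambda>(S, w). if movable S w then (insert (hd w) S, tl w) else (S - {Min S}, Min S # w))"
  have finW: "finite (W S)" for S using fin by (simp add: W_def)
  have "(\<Sum>S | S \<subseteq> V \<and> chain S. (-1) ^ card S * int (card (W S))) =
      (\<Sum>S | S \<subseteq> V \<and> chain S. \<Sum>w\<in>W S. (-1) ^ card S)"
    by (simp add: mult.commute)
  also have "\<dots> = (\<Sum>(S, w)\<in>Sigma {S. S \<subseteq> V \<and> chain S} W. (-1) ^ card S)"
    using fin finW by (intro sum.Sigma) auto
  also have "\<dots> = 0"
  proof (rule sum_sign_reversing_involution[of _ h])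
    fix p assume "p \<in> Sigma {S. S \<subseteq> V \<and> chain S} W"
    then obtain S w where p: "p = (S, w)" and S: "S \<subseteq> V" "chain S" and "w \<in> W S" by auto
    then have w: "distinct w" "set w = V - S" "successively (\<lambda>a b. \<not> B a b) w"
      by (auto simp: W_def words_on_def)
    have finS: "finite S" using S fin finite_subset by blast
    have "h p \<in> Sigma {S. S \<subseteq> V \<and> chain S} W \<and> h (h p) = p \<and>
      (case h p of (S, w) \<Rightarrow> (-1) ^ card S) = - (case p of (S, w) \<Rightarrow> (-1 :: int) ^ card S)"
    proof (cases "movable S w")
      case True
      then obtain y v where wy: "w = y # v" and By: "\<And>s. s \<in> S \<Longrightarrow> B s y"
        by (cases w) (auto simp: movable_def)
      have hp: "h p = (insert y S, v)" using True by (simp add: h_def p wy)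
      have y: "y \<in> V" "y \<notin> S" using w(2) wy by auto
      have "chain (insert y S)"
        using S(2) By less unfolding chain_def by (metis insert_iff order_less_asym order_less_irrefl)
      moreover have "v \<in> W (insert y S)"
        using w unfolding W_def words_on_def wy by (auto simp: successively_Cons)
      ultimately have "h p \<in> Sigma {S. S \<subseteq> V \<and> chain S} W" using y S by (simp add: hp)
      \<comment> \<open>The moved letter becomes the new minimum and, as the first step of
        \<open>w\<close> avoids \<open>B\<close>, the next letter cannot follow it; hence
        \<open>h\<close> moves it back.\<close>
      moreover have "Min (insert y S) = y"
        using By less finS by (intro Min_eqI) (auto intro: less_imp_le)
      moreover have "\<not> movable (insert y S) v"
        using w(3) unfolding movable_def wy by (auto simp: successively_Cons)
      ultimately have "h p \<in> Sigma {S. S \<subseteq> V \<and> chain S} W" "h (h p) = p"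
        using y unfolding hp by (auto simp: h_def p wy)
      moreover have "(case h p of (S, w) \<Rightarrow> (-1) ^ card S) = - (case p of (S, w) \<Rightarrow> (-1 :: int) ^ card S)"
        unfolding hp using y finS by (simp add: p)
      ultimately show ?thesis by blast
    next
      case False
      have "S \<noteq> {}"
      proof
        assume "S = {}"
        then have "w \<noteq> []" using w(2) ne by auto
        then show False using False \<open>S = {}\<close> by (simp add: movable_def)
      qed
      define m where "m = Min S"
      have m: "m \<in> S" and mle: "\<And>s. s \<in> S \<Longrightarrow> m \<le> s"
        using finS \<open>S \<noteq> {}\<close> by (auto simp: m_def)
      have Bm: "B s m" if "s \<in> S" "s \<noteq> m" for s
        using S(2) that m mle[of s] by (auto simp: chain_def)
      have hp: "h p = (S - {m}, m # w)" using False by (simp add: h_def p m_def)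
      \<comment> \<open>By transitivity, \<open>B m (hd w)\<close> would let \<open>hd w\<close>
        follow every member of \<open>S\<close>, making the pair movable.\<close>
      have "\<not> B m (hd w)" if "w \<noteq> []"
      proof
        assume "B m (hd w)"
        then have "B s (hd w)" if "s \<in> S" for s
          using Bm[OF that] transpD[OF trans] by (cases "s = m") blast+
        then show False using False \<open>w \<noteq> []\<close> by (simp add: movable_def)
      qed
      then have "m # w \<in> W (S - {m})"
        using w S m unfolding W_def words_on_def by (auto simp: successively_Cons)
      moreover have "chain (S - {m})" using S(2) by (auto simp: chain_def)
      ultimately have "h p \<in> Sigma {S. S \<subseteq> V \<and> chain S} W" using S by (auto simp: hp)
      moreover have "movable (S - {m}) (m # w)" using Bm by (auto simp: movable_def)
      then have "h (h p) = p" unfolding hp using m by (auto simp: h_def p)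
      moreover have "card S = Suc (card (S - {m}))" by (rule card.remove[OF finS m])
      then have "(case h p of (S, w) \<Rightarrow> (-1) ^ card S) = - (case p of (S, w) \<Rightarrow> (-1 :: int) ^ card S)"
        unfolding hp by (simp add: p)
      ultimately show ?thesis by blast
    qed
    then show "h p \<in> Sigma {S. S \<subseteq> V \<and> chain S} W" "h (h p) = p"
      "(case h p of (S, w) \<Rightarrow> (-1) ^ card S) = - (case p of (S, w) \<Rightarrow> (-1 :: int) ^ card S)"
      by blast+
  qed
  finally show ?thesis by (simp add: chain_def W_def)
qed

section \<open>Comparison of the two counts\<close>

text \<open>The term for the empty set is the value at \<open>V\<close> itself, and all other terms
  involve proper subsets of \<open>V\<close>, so the recursion determines a function from its value
  at the empty set.\<close>

lemma eq_by_alternating_recursion: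
  fixes f g :: "'a set \<Rightarrow> int"
  assumes "finite V" and empty: "P {}" "f {} = g {}"
    and f: "\<And>V. finite V \<Longrightarrow> V \<noteq> {} \<Longrightarrow> (\<Sum>S | S \<subseteq> V \<and> P S. (-1) ^ card S * f (V - S)) = 0"
    and g: "\<And>V. finite V \<Longrightarrow> V \<noteq> {} \<Longrightarrow> (\<Sum>S | S \<subseteq> V \<and> P S. (-1) ^ card S * g (V - S)) = 0"
  shows "f V = g V"
  using \<open>finite V\<close>
proof (induction V rule: finite_psubset_induct)
  case (psubset V)
  show ?case
  proof (cases "V = {}")
    case False
    define Q where "Q = {S. S \<subseteq> V \<and> P S}"
    have Q: "finite Q" "{} \<in> Q" using psubset.hyps empty(1) by (auto simp: Q_def)
    have split: "(\<Sum>S\<in>Q. (-1) ^ card S * k (V - S)) =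
        k V + (\<Sum>S\<in>Q - {{}}. (-1) ^ card S * k (V - S))" for k :: "'a set \<Rightarrow> int"
      using sum.remove[OF Q, of "\<lambda>S. (-1) ^ card S * k (V - S)"] by simp
    have "(\<Sum>S\<in>Q - {{}}. (-1) ^ card S * f (V - S)) = (\<Sum>S\<in>Q - {{}}. (-1) ^ card S * g (V - S))"
      using psubset.IH by (intro sum.cong) (auto simp: Q_def)
    then show ?thesis
      using f[OF psubset.hyps False] g[OF psubset.hyps False] split[of f] split[of g]
      by (simp add: Q_def)
  qed (use empty in simp)
qed

lemma card_words_on_eq_card_dumont:
  assumes "finite V"
  shows "card (words_on (\<lambda>a b. b < a \<longrightarrow> even a \<and> odd b) V) = card (perms_on dumont_arc V)"
proof -
  \<comment> \<open>The forbidden steps: every descent except those from even to odd.\<close>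
  let ?B = "\<lambda>a b :: nat. b < a \<and> \<not> (even a \<and> odd b)"
  have "int (card (words_on (\<lambda>a b. \<not> ?B a b) V)) = int (card (perms_on dumont_arc V))"
  proof (rule eq_by_alternating_recursion[OF assms, of evens_before_odds])
    fix V :: "nat set" assume V: "finite V" "V \<noteq> {}"
    have chain: "(\<forall>a\<in>S. \<forall>b\<in>S. b < a \<longrightarrow> ?B a b) \<longleftrightarrow> evens_before_odds S" for S
      unfolding evens_before_odds_def by (metis linorder_neqE_nat order_less_asym)
    \<comment> \<open>If \<open>c < b < a\<close> with \<open>a\<close> even and \<open>c\<close>
      odd, then one of the two steps goes from even to odd, whatever the parity of
      \<open>b\<close>.\<close>
    have "transp ?B" by (auto simp: transp_def)
    from sum_chain_words[OF V this] show
      "(\<Sum>S | S \<subseteq> V \<and> evens_before_odds S. (-1) ^ card S * int (card (words_on (\<lambda>a b. \<not> ?B a b) (V - S)))) = 0"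
      unfolding chain by blast
    \<comment> \<open>The minor is the indicator of goodness, so the other subsets enter with
      coefficient zero.\<close>
    have "(\<Sum>S | S \<subseteq> V \<and> evens_before_odds S. (-1) ^ card S * int (card (perms_on dumont_arc (V - S)))) =
        (\<Sum>S\<in>Pow V. (-1) ^ card S * (\<Sum>\<pi>\<in>perms_on dumont_arc S. sign \<pi>) *
          int (card (perms_on dumont_arc (V - S))))"
      using V sum_sign_dumont finite_subset[OF _ V(1)]
      by (intro sum.mono_neutral_cong_left) auto
    then show "(\<Sum>S | S \<subseteq> V \<and> evens_before_odds S. (-1) ^ card S * int (card (perms_on dumont_arc (V - S)))) = 0"
      using sum_minor_permanent[OF V] by simp
  qed (auto simp: evens_before_odds_def)
  moreover have "(\<lambda>a b. \<not> ?B a b) = (\<lambda>a b. b < a \<longrightarrow> even a \<and> odd b)" by auto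
  ultimately show ?thesis by simp
qed

section \<open>One-line notation and Dumont derangements\<close>

lemma card_permutes_successively:
  fixes m :: nat
  shows "card {\<sigma>. \<sigma> permutes {1..m} \<and> (\<forall>i\<in>{1..m - 1}. R (\<sigma> i) (\<sigma> (i + 1)))} = card (words_on R {1..m})"
\<comment> \<open>Lists are indexed from 0, hence \<open>i - 1\<close>; outside the interval the
  inverse has to be the identity, as \<open>permutes\<close> demands.\<close>
proof (rule bij_betw_same_card, rule bij_betw_byWitness[of _ "\<lambda>w i. if i \<in> {1..m} then w ! (i - 1) else i"])
  let ?A = "{\<sigma>. \<sigma> permutes {1..m} \<and> (\<forall>i\<in>{1..m - 1}. R (\<sigma> i) (\<sigma> (i + 1)))}"
  let ?word = "\<lambda>\<sigma> :: nat \<Rightarrow> nat. map \<sigma> [1..<Suc m]"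
  let ?perm = "\<lambda>w i. if i \<in> {1..m} then w ! (i - 1) else i"
  have len: "length w = m" if "w \<in> words_on R {1..m}" for w
    using that distinct_card[of w] by (auto simp: words_on_def)
  have nth: "?word \<sigma> ! k = \<sigma> (Suc k)" if "k < m" for \<sigma> k
    using that by (simp del: upt_Suc)
  show "\<forall>\<sigma>\<in>?A. ?perm (?word \<sigma>) = \<sigma>"
  proof
    fix \<sigma> assume "\<sigma> \<in> ?A"
    then have "\<sigma> x = x" if "x \<notin> {1..m}" for x using that permutes_not_in[of \<sigma> "{1..m}" x] by blast
    then show "?perm (?word \<sigma>) = \<sigma>" by (auto simp: fun_eq_iff nth simp del: upt_Suc)
  qed
  show "\<forall>w\<in>words_on R {1..m}. ?word (?perm w) = w"
    by (auto intro!: nth_equalityI simp: len simp del: upt_Suc)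
  show "?word ` ?A \<subseteq> words_on R {1..m}"
  proof clarify
    fix \<sigma> assume \<sigma>: "\<sigma> permutes {1..m}" and R: "\<forall>i\<in>{1..m - 1}. R (\<sigma> i) (\<sigma> (i + 1))"
    have "distinct (?word \<sigma>)" using permutes_inj_on[OF \<sigma>] by (simp add: distinct_map del: upt_Suc)
    moreover have "set (?word \<sigma>) = {1..m}"
      using permutes_image[OF \<sigma>] by (simp add: atLeastLessThanSuc_atLeastAtMost del: upt_Suc)
    moreover have "successively R (?word \<sigma>)"
      using R by (auto simp: successively_conv_nth nth simp del: upt_Suc)
    ultimately show "?word \<sigma> \<in> words_on R {1..m}" by (simp add: words_on_def)
  qed
  show "?perm ` words_on R {1..m} \<subseteq> ?A"
  proof clarify
    fix w assume w: "w \<in> words_on R {1..m}"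
    then have w': "distinct w" "set w = {1..m}" "successively R w" by (auto simp: words_on_def)
    have "?perm w permutes {1..m}"
    proof (rule inj_imp_permutes)
      show "inj_on (?perm w) {1..m}"
        using w'(1) len[OF w] by (auto simp: inj_on_def nth_eq_iff_index_eq)
      show "?perm w x \<in> {1..m}" if "x \<in> {1..m}" for x
        using that nth_mem[of "x - 1" w] w'(2) len[OF w] by auto
    qed auto
    moreover have "R (?perm w i) (?perm w (i + 1))" if "i \<in> {1..m - 1}" for i
      using w'(3) that len[OF w] unfolding successively_conv_nth
      by (auto dest!: spec[of _ "i - 1"])
    ultimately show "?perm w permutes {1..m} \<and> (\<forall>i\<in>{1..m - 1}. R (?perm w i) (?perm w (i + 1)))"
      by blast
  qed
qed

text \<open>A Dumont derangement of \<^term>\<open>{1..2 * n + 2}\<close> satisfies \<^term>\<open>\<sigma> 2 = 1\<close> and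
  \<^term>\<open>\<sigma> (2 * n + 1) = 2 * n + 2\<close>; deleting these two arcs and renumbering positions
  (by \<^term>\<open>\<beta>\<close>) and values (by \<^term>\<open>\<alpha>\<close>) makes the inequalities weak.\<close>

lemma median_genocchi_eq: "median_genocchi n = card (perms_on dumont_arc {1..2 * n})"
proof -
  define U where "U = {1..2 * n + 2}"
  \<comment> \<open>\<open>\<alpha>\<close> lowers values by 1, with 1 going to
    \<open>2 * n + 1\<close>; \<open>\<beta>\<close> raises even positions by 2 and keeps small odd
    ones. As \<open>\<beta>\<close> sends \<open>2 * n + 1\<close> to 2 and \<open>2 * n + 2\<close>
    to \<open>2 * n + 1\<close>, the two forced arcs become fixed points of
    \<open>\<alpha> \<circ> \<sigma> \<circ> \<beta>\<close>.\<close>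
  define \<alpha> where "\<alpha> p = (if p = 1 then 2 * n + 1 else if 2 \<le> p \<and> p \<le> 2 * n + 1 then p - 1 else p)" for p
  define \<alpha>' where "\<alpha>' p = (if p = 2 * n + 1 then 1 else if 1 \<le> p \<and> p \<le> 2 * n then p + 1 else p)" for p
  define \<beta> where "\<beta> p = (if even p \<and> 1 \<le> p \<and> p \<le> 2 * n then p + 2 else if p = 2 * n + 1 then 2
    else if p = 2 * n + 2 then 2 * n + 1 else p)" for p
  define \<beta>' where "\<beta>' p = (if p = 2 then 2 * n + 1 else if even p \<and> 4 \<le> p \<and> p \<le> 2 * n + 2 then p - 2
    else if p = 2 * n + 1 then 2 * n + 2 else p)" for p
  have \<alpha>\<alpha>': "\<alpha> (\<alpha>' p) = p" "\<alpha>' (\<alpha> p) = p" for p by (auto simp: \<alpha>_def \<alpha>'_def)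
  have \<beta>'_cases: "p = 2 \<or> (even p \<and> 4 \<le> p \<and> p \<le> 2 * n + 2) \<or> p = 2 * n + 1 \<or>
      (odd p \<and> p \<noteq> 2 * n + 1) \<or> p = 0 \<or> 2 * n + 2 < p" for p
    by presburger
  have \<beta>_cases: "(even p \<and> 1 \<le> p \<and> p \<le> 2 * n) \<or> p = 2 * n + 1 \<or> p = 2 * n + 2 \<or>
      (odd p \<and> p \<noteq> 2 * n + 1) \<or> p = 0 \<or> 2 * n + 2 < p" for p
    by presburger
  have two: "2 * n + 1 \<noteq> 2" by presburger
  have \<beta>\<beta>': "\<beta> (\<beta>' p) = p" for p
    using \<beta>'_cases[of p] two by (elim disjE) (auto simp: \<beta>_def \<beta>'_def)
  have \<beta>'\<beta>: "\<beta>' (\<beta> p) = p" for p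
    using \<beta>_cases[of p] two by (elim disjE) (auto simp: \<beta>_def \<beta>'_def)
  have permI: "f permutes U" if "\<And>p. g (f p) = p" "\<And>p. p \<in> U \<Longrightarrow> f p \<in> U" "\<And>p. p \<notin> U \<Longrightarrow> f p = p"
    for f g
    using that by (intro inj_imp_permutes inj_on_inverseI[of _ g]) (auto simp: U_def)
  have "\<alpha> permutes U" by (rule permI[of \<alpha>' \<alpha>, OF \<alpha>\<alpha>'(2)]) (auto simp: \<alpha>_def U_def)
  moreover have "\<alpha>' permutes U" by (rule permI[of \<alpha> \<alpha>', OF \<alpha>\<alpha>'(1)]) (auto simp: \<alpha>'_def U_def)
  moreover have "\<beta> permutes U" by (rule permI[of \<beta>' \<beta>, OF \<beta>'\<beta>]) (auto simp: \<beta>_def U_def)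
  moreover have "\<beta>' permutes U" by (rule permI[of \<beta> \<beta>', OF \<beta>\<beta>']) (auto simp: \<beta>'_def U_def)
  ultimately have perms: "\<alpha> permutes U" "\<alpha>' permutes U" "\<beta> permutes U" "\<beta>' permutes U" by blast+
  let ?D = "{\<sigma>. dumont_derangement (n + 1) \<sigma>}"
  have "bij_betw (\<lambda>\<sigma>. \<alpha> \<circ> \<sigma> \<circ> \<beta>) ?D (perms_on dumont_arc {1..2 * n})"
  proof (rule bij_betw_byWitness[of _ "\<lambda>\<tau>. \<alpha>' \<circ> \<tau> \<circ> \<beta>'"])
    show "(\<lambda>\<sigma>. \<alpha> \<circ> \<sigma> \<circ> \<beta>) ` ?D \<subseteq> perms_on dumont_arc {1..2 * n}"
    proof clarify
      fix \<sigma> assume D: "dumont_derangement (n + 1) \<sigma>"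
      then have \<sigma>: "\<sigma> permutes U" by (simp add: dumont_derangement_def U_def)
      have low: "\<sigma> (2 * i) < 2 * i" and high: "2 * i - 1 < \<sigma> (2 * i - 1)" if "i \<in> {1..n + 1}" for i
        using D that by (auto simp: dumont_derangement_def)
      have even: "\<sigma> p < p" if "even p" "p \<in> U" for p
        using low[of "p div 2"] that by (auto simp: U_def)
      have odd: "p < \<sigma> p" if "odd p" "p \<in> U" for p
      proof -
        define k where "k = p div 2"
        have "p = 2 * k + 1" using that(1) by (simp add: k_def)
        then show ?thesis using high[of "k + 1"] that(2) by (auto simp: U_def)
      qed
      have U: "\<sigma> p \<in> U \<longleftrightarrow> p \<in> U" for p by (rule permutes_in_image[OF \<sigma>])
      have first: "\<sigma> 2 = 1" using even[of 2] U[of 2] by (auto simp: U_def)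
      have last: "\<sigma> (2 * n + 1) = 2 * n + 2" using odd[of "2 * n + 1"] U[of "2 * n + 1"] by (auto simp: U_def)
      have inj: "\<sigma> p = \<sigma> q \<longleftrightarrow> p = q" for p q by (rule inj_eq[OF permutes_inj[OF \<sigma>]])
      have "\<alpha> \<circ> \<sigma> \<circ> \<beta> permutes U" using \<sigma> perms by (intro permutes_compose)
      then have "\<alpha> \<circ> \<sigma> \<circ> \<beta> permutes {1..2 * n}"
      proof (rule permutes_superset)
        fix x assume "x \<in> U - {1..2 * n}"
        then have "x = 2 * n + 1 \<or> x = 2 * n + 2" by (auto simp: U_def)
        then show "(\<alpha> \<circ> \<sigma> \<circ> \<beta>) x = x" using first last by (auto simp: \<alpha>_def \<beta>_def)
      qed
      moreover have "dumont_arc p ((\<alpha> \<circ> \<sigma> \<circ> \<beta>) p)" if p: "p \<in> {1..2 * n}" for p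
      proof (cases "even p")
        case True
        \<comment> \<open>The value 1 is taken by position 2, so \<open>\<alpha>\<close> lowers
          \<open>\<sigma> (p + 2)\<close> by exactly 1, from at most \<open>p + 1\<close> to at most
          \<open>p\<close>.\<close>
        then have "\<sigma> (p + 2) < p + 2" "\<sigma> (p + 2) \<in> U" "\<sigma> (p + 2) \<noteq> 1"
          using even[of "p + 2"] U[of "p + 2"] p inj[of "p + 2" 2] first by (auto simp: U_def)
        then show ?thesis using True p by (auto simp: dumont_arc_def \<alpha>_def \<beta>_def U_def)
      next
        case False
        \<comment> \<open>The value \<open>2 * n + 2\<close> is taken by position
          \<open>2 * n + 1\<close>, so here too \<open>\<alpha>\<close> subtracts 1 and the strict
          bound becomes weak.\<close>
        then have "p \<noteq> 2 * n + 1" "p < \<sigma> p" "\<sigma> p \<in> U" "\<sigma> p \<noteq> 2 * n + 2"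
          using odd[of p] U[of p] p inj[of p "2 * n + 1"] last by (auto simp: U_def)
        then show ?thesis using False p by (auto simp: dumont_arc_def \<alpha>_def \<beta>_def U_def)
      qed
      ultimately show "\<alpha> \<circ> \<sigma> \<circ> \<beta> \<in> perms_on dumont_arc {1..2 * n}" by (simp add: perms_on_def)
    qed
    show "(\<lambda>\<tau>. \<alpha>' \<circ> \<tau> \<circ> \<beta>') ` perms_on dumont_arc {1..2 * n} \<subseteq> ?D"
    proof clarify
      fix \<tau> assume "\<tau> \<in> perms_on dumont_arc {1..2 * n}"
      then have \<tau>: "\<tau> permutes {1..2 * n}" and arc: "\<And>p. p \<in> {1..2 * n} \<Longrightarrow> dumont_arc p (\<tau> p)"
        by (auto simp: perms_on_def)
      have "\<tau> permutes U" using permutes_subset[OF \<tau>] by (auto simp: U_def)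
      then have "\<alpha>' \<circ> \<tau> \<circ> \<beta>' permutes U" using perms by (intro permutes_compose)
      moreover have "\<alpha>' (\<tau> (\<beta>' (2 * i))) < 2 * i" if i: "i \<in> {1..n + 1}" for i
      proof (cases "i = 1")
        case True
        \<comment> \<open>Position 2 is renumbered to \<open>2 * n + 1\<close>, which
          \<open>\<tau>\<close> fixes as it lies outside the ground set; \<open>\<alpha>'\<close>
          then sends it to 1.\<close>
        then show ?thesis using permutes_not_in[OF \<tau>, of "2 * n + 1"] by (simp add: \<alpha>'_def \<beta>'_def)
      next
        case False
        then have k: "2 * (i - 1) \<in> {1..2 * n}" using i by auto
        have "\<tau> (2 * (i - 1)) \<le> 2 * (i - 1)" using arc[OF k] by (simp add: dumont_arc_def)
        moreover have "\<tau> (2 * (i - 1)) \<in> {1..2 * n}" using k unfolding permutes_in_image[OF \<tau>] .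
        moreover have "\<beta>' (2 * i) = 2 * (i - 1)" using False i by (auto simp: \<beta>'_def)
        ultimately show ?thesis using False i by (auto simp: \<alpha>'_def)
      qed
      moreover have "2 * i - 1 < \<alpha>' (\<tau> (\<beta>' (2 * i - 1)))" if i: "i \<in> {1..n + 1}" for i
      proof (cases "i = n + 1")
        case True
        then show ?thesis using permutes_not_in[OF \<tau>, of "2 * n + 2"] by (simp add: \<alpha>'_def \<beta>'_def)
      next
        case False
        then have k: "2 * i - 1 \<in> {1..2 * n}" "odd (2 * i - 1)" using i by auto
        have "2 * i - 1 \<le> \<tau> (2 * i - 1)" using arc[OF k(1)] k(2) by (simp add: dumont_arc_def)
        moreover have "\<tau> (2 * i - 1) \<in> {1..2 * n}" using k(1) unfolding permutes_in_image[OF \<tau>] .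
        moreover have "\<beta>' (2 * i - 1) = 2 * i - 1"
        proof -
          have "2 * i - 1 \<noteq> 2" "2 * i - 1 \<noteq> 2 * n + 1" using False i by (auto, presburger)
          then show ?thesis using k(2) by (simp add: \<beta>'_def)
        qed
        ultimately show ?thesis using False i by (auto simp: \<alpha>'_def)
      qed
      ultimately show "dumont_derangement (n + 1) (\<alpha>' \<circ> \<tau> \<circ> \<beta>')"
        by (simp add: dumont_derangement_def U_def)
    qed
  qed (auto simp: fun_eq_iff \<alpha>\<alpha>' \<beta>\<beta>' \<beta>'\<beta>)
  then show ?thesis unfolding median_genocchi_def by (rule bij_betw_same_card)
qed

theorem theorem3p8:
  fixes n :: nat
  assumes "n \<ge> 1"
  shows "median_genocchi n =
    card {\<sigma> :: nat \<Rightarrow> nat. \<sigma> permutes {1..2 * n} \<and>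
      (\<forall>i\<in>{1..2 * n - 1}. \<sigma> i > \<sigma> (i + 1) \<longrightarrow> even (\<sigma> i) \<and> odd (\<sigma> (i + 1)))}"
  using card_permutes_successively[of "2 * n" "\<lambda>a b. b < a \<longrightarrow> even a \<and> odd b"]
    card_words_on_eq_card_dumont[of "{1..2 * n}"]
  by (simp add: median_genocchi_eq)

end
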